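(* There is an algorithm which, given an $n\times n$ binary matrix $M$, decides whether $M$ is optimal using $O(n^{2}\log n)$ elementary operations (additions and comparisons).
   Context: Biker–hiker model: $n$ travellers $t_1,\dots,t_n$; posts $P_0,\dots,P_n$ at unit spacing; stage $s_j$ is the leg from $P_{j-1}$ to $P_j$. All start at $P_0$ at time $0$, walk at common speed $w$, cycle at common speed $v>w$, mode changes take no time. The $n\times n$ binary matrix $M=(m_{i,j})$ prescribes that traveller $t_i$ cycles stage $s_j$ iff $m_{i,j}=1$ and walks it otherwise. $M$ is $k$-uniform if every row and every column has exactly $k$ entries equal to $1$. Bicycles start at $P_0$, move only when ridden by one rider, and a traveller due to cycle $s_j$ must take a bicycle present at $P_{j-1}$ when he arrives there. $M$ is optimal if it is $k$-uniform for some $k$ and, with $k$ bicycles, the scheme can be executed with no traveller ever having to wait for a bicycle. *)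

theory Defs
  imports
    Complex_Main
    "HOL-Library.Disjoint_Sets"
    "HOL-Library.Landau_Symbols"
    "Jordan_Normal_Form.Matrix"
begin

section \<open>The biker--hiker model\<close>

text \<open>
  Indices are 0-based: row \<open>i < n\<close> is traveller \<open>t\<^sub>i\<^sub>+\<^sub>1\<close>, and column \<open>j < n\<close> is stage
  \<open>s\<^sub>j\<^sub>+\<^sub>1\<close>, the leg from post \<open>P\<^sub>j\<close> to post \<open>P\<^sub>j\<^sub>+\<^sub>1\<close>. Post \<open>P\<^sub>j\<close> is at position \<open>j\<close> on the line.
  The walking speed is \<open>w\<close> and the cycling speed is \<open>v\<close>.
\<close>

definition binary_mat :: "nat \<Rightarrow> nat mat \<Rightarrow> bool" where
  "binary_mat n M \<longleftrightarrow> M \<in> carrier_mat n n \<and> elements_mat M \<subseteq> {0, 1}"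

definition k_uniform :: "nat \<Rightarrow> nat \<Rightarrow> nat mat \<Rightarrow> bool" where
  "k_uniform n k M \<longleftrightarrow>
     (\<forall>i<n. card {j. j < n \<and> M $$ (i, j) = 1} = k) \<and>
     (\<forall>j<n. card {i. i < n \<and> M $$ (i, j) = 1} = k)"

definition stage_time :: "real \<Rightarrow> real \<Rightarrow> nat mat \<Rightarrow> nat \<Rightarrow> nat \<Rightarrow> real" where
  "stage_time v w M i j = (if M $$ (i, j) = 1 then 1 / v else 1 / w)"

text \<open>The time at which a traveller who never waits reaches post \<open>P\<^sub>j\<close> (and leaves it again).\<close>

definition arrival :: "real \<Rightarrow> real \<Rightarrow> nat mat \<Rightarrow> nat \<Rightarrow> nat \<Rightarrow> real" where
  "arrival v w M i j = (\<Sum>l<j. stage_time v w M i l)"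

text \<open>
  An execution is given by \<open>b i j\<close>, the bicycle (numbered \<open>0, \<dots>, k - 1\<close>) used by traveller \<open>i\<close>
  on stage \<open>j\<close> (relevant only when \<open>i\<close> is due to cycle \<open>j\<close>), and by \<open>pos c t\<close>, the position of
  bicycle \<open>c\<close> at time \<open>t \<ge> 0\<close>.
\<close>

definition rides :: "nat \<Rightarrow> nat mat \<Rightarrow> (nat \<Rightarrow> nat \<Rightarrow> nat) \<Rightarrow> nat \<Rightarrow> (nat \<times> nat) set" where
  "rides n M b c = {(i, j). i < n \<and> j < n \<and> M $$ (i, j) = 1 \<and> b i j = c}"

text \<open>
  The period of a ride is half-open, so that a bicycle dropped at a post at time \<open>t\<close> may be
  picked up there by another traveller at the same time \<open>t\<close>.
\<close>

definition ride_period :: "real \<Rightarrow> real \<Rightarrow> nat mat \<Rightarrow> nat \<times> nat \<Rightarrow> real set" where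
  "ride_period v w M = (\<lambda>(i, j). {arrival v w M i j ..< arrival v w M i (Suc j)})"

text \<open>
  The third conjunct says that the bicycle stays with its rider throughout the ride; at the
  start of the ride it says that the bicycle is present at \<open>P\<^sub>j\<close> when the rider arrives there.
  The fourth says that a bicycle has at most one rider at a time, the fifth that it moves
  only when ridden.
\<close>

definition no_wait_execution ::
  "real \<Rightarrow> real \<Rightarrow> nat \<Rightarrow> nat mat \<Rightarrow> nat \<Rightarrow>
     (nat \<Rightarrow> nat \<Rightarrow> nat) \<Rightarrow> (nat \<Rightarrow> real \<Rightarrow> real) \<Rightarrow> bool" where
  "no_wait_execution v w n M k b pos \<longleftrightarrow>
     (\<forall>i<n. \<forall>j<n. M $$ (i, j) = 1 \<longrightarrow> b i j < k) \<and>
     (\<forall>c<k. pos c 0 = 0) \<and>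
     (\<forall>c<k. \<forall>(i, j) \<in> rides n M b c.
        \<forall>t \<in> {arrival v w M i j .. arrival v w M i (Suc j)}.
          pos c t = real j + v * (t - arrival v w M i j)) \<and>
     (\<forall>c<k. disjoint_family_on (ride_period v w M) (rides n M b c)) \<and>
     (\<forall>c<k. \<forall>s t. 0 \<le> s \<and> s \<le> t \<and>
        (\<forall>r \<in> rides n M b c. ride_period v w M r \<inter> {s..<t} = {}) \<longrightarrow> pos c s = pos c t)"

definition optimal :: "real \<Rightarrow> real \<Rightarrow> nat \<Rightarrow> nat mat \<Rightarrow> bool" where
  "optimal v w n M \<longleftrightarrow>
     (\<exists>k. k_uniform n k M \<and> (\<exists>b pos. no_wait_execution v w n M k b pos))"


section \<open>Algorithms\<close>

text \<open>
  Algorithms are programs for a random access machine over the natural numbers whose only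
  arithmetic operation is addition and whose only test is the comparison \<open><\<close>. A state consists
  of registers and of an indirectly addressed memory. Every executed instruction, data
  movement included, costs one unit, so the cost bounds the number of additions and
  comparisons. A program is a finite object and cannot depend on the input.
\<close>

type_synonym state = "(nat \<Rightarrow> nat) \<times> (nat \<Rightarrow> nat)"

datatype prog =
    Const nat nat             \<comment> \<open>\<open>Const x c\<close>: \<open>R\<^sub>x := c\<close>\<close>
  | Copy nat nat              \<comment> \<open>\<open>Copy x y\<close>: \<open>R\<^sub>x := R\<^sub>y\<close>\<close>
  | Plus nat nat nat          \<comment> \<open>\<open>Plus x y z\<close>: \<open>R\<^sub>x := R\<^sub>y + R\<^sub>z\<close>\<close>
  | Load nat nat              \<comment> \<open>\<open>Load x y\<close>: \<open>R\<^sub>x := mem[R\<^sub>y]\<close>\<close>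
  | Store nat nat             \<comment> \<open>\<open>Store x y\<close>: \<open>mem[R\<^sub>x] := R\<^sub>y\<close>\<close>
  | Skip
  | Seq prog prog
  | IfLess nat nat prog prog  \<comment> \<open>\<open>IfLess x y p q\<close>: if \<open>R\<^sub>x < R\<^sub>y\<close> then \<open>p\<close> else \<open>q\<close>\<close>
  | WhileLess nat nat prog    \<comment> \<open>\<open>WhileLess x y p\<close>: while \<open>R\<^sub>x < R\<^sub>y\<close> do \<open>p\<close>\<close>

text \<open>\<open>exec p s t s'\<close>: started in \<open>s\<close>, program \<open>p\<close> halts in \<open>s'\<close> at cost \<open>t\<close>.\<close>

inductive exec :: "prog \<Rightarrow> state \<Rightarrow> nat \<Rightarrow> state \<Rightarrow> bool" where
  Const: "exec (Const x c) (R, m) 1 (R(x := c), m)"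
| Copy: "exec (Copy x y) (R, m) 1 (R(x := R y), m)"
| Plus: "exec (Plus x y z) (R, m) 1 (R(x := R y + R z), m)"
| Load: "exec (Load x y) (R, m) 1 (R(x := m (R y)), m)"
| Store: "exec (Store x y) (R, m) 1 (R, m(R x := R y))"
| Skip: "exec Skip s 1 s"
| Seq: "exec p s1 t1 s2 \<Longrightarrow> exec q s2 t2 s3 \<Longrightarrow> exec (Seq p q) s1 (t1 + t2) s3"
| IfTrue: "fst s x < fst s y \<Longrightarrow> exec p s t s' \<Longrightarrow> exec (IfLess x y p q) s (1 + t) s'"
| IfFalse: "\<not> fst s x < fst s y \<Longrightarrow> exec q s t s' \<Longrightarrow> exec (IfLess x y p q) s (1 + t) s'"
| WhileFalse: "\<not> fst s x < fst s y \<Longrightarrow> exec (WhileLess x y p) s 1 s"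
| WhileTrue: "fst s1 x < fst s1 y \<Longrightarrow> exec p s1 t1 s2 \<Longrightarrow> exec (WhileLess x y p) s2 t2 s3
    \<Longrightarrow> exec (WhileLess x y p) s1 (1 + t1 + t2) s3"

lemma exec_deterministic:
  assumes "exec p s t s'" and "exec p s u s''"
  shows "u = t \<and> s'' = s'"
  using assms
proof (induction arbitrary: u s'' rule: exec.induct)
  case Seq
  from Seq.prems show ?case by (cases rule: exec.cases) (use Seq.IH in blast)+
next
  case IfTrue
  from IfTrue.prems show ?case
    by (cases rule: exec.cases) (use IfTrue.IH IfTrue.hyps in blast)+
next
  case IfFalse
  from IfFalse.prems show ?case
    by (cases rule: exec.cases) (use IfFalse.IH IfFalse.hyps in blast)+
next
  case WhileFalse
  from WhileFalse.prems show ?case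
    by (cases rule: exec.cases) (use WhileFalse.hyps in blast)+
next
  case WhileTrue
  from WhileTrue.prems show ?case
    by (cases rule: exec.cases) (use WhileTrue.IH WhileTrue.hyps in blast)+
qed (auto elim: exec.cases)

text \<open>Input: \<open>n\<close> in register \<open>0\<close>, and the entries of \<open>M\<close> row by row in memory.\<close>

definition input_state :: "nat \<Rightarrow> nat mat \<Rightarrow> state" where
  "input_state n M =
     ((\<lambda>_. 0)(0 := n), (\<lambda>a. if a < n * n then M $$ (a div n, a mod n) else 0))"

definition answer :: "state \<Rightarrow> nat" where
  "answer s = fst s 0"

end

theory Submission
  imports Defs
begin

text \<open>
  Without waiting, traveller \<open>i\<close> reaches post \<open>P\<^sub>j\<close> the earlier the more of the first \<open>j\<close> stages
  he has cycled. Under \<open>k\<close>-uniformity with \<open>k\<close> bicycles, every bicycle is ridden exactly once on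
  every stage, so at each post the arriving cyclists must be matched bijectively with the
  departing ones, none of whom may arrive before his partner. By a greedy matching this is
  possible iff, for every \<open>x\<close>, the arriving cyclists with at most \<open>x\<close> cycled stages are no more
  numerous than the departing ones. This does not involve the speeds, and a counting sort of
  the cyclists of each stage checks it for all posts in quadratic time.
\<close>

section \<open>Reasoning about programs\<close>

text \<open>Total correctness: a halting run is demanded, and by \<open>exec_deterministic\<close>
  it is the only one. Passing the cost to \<open>Q\<close> lets time bounds be proved along with
  results.\<close>

definition wp :: "prog \<Rightarrow> (nat \<Rightarrow> state \<Rightarrow> bool) \<Rightarrow> state \<Rightarrow> bool" where
  "wp p Q s \<longleftrightarrow> (\<exists>t s'. exec p s t s' \<and> Q t s')"

\<comment> \<open>\<open>WhileLess\<close> is left out because its unfolding would rewrite forever;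
  \<open>wp_for\<close> treats it.\<close>
inductive_simps exec_iffs:
  "exec (Const x c) s t s'" "exec (Copy x y) s t s'" "exec (Plus x y z) s t s'"
  "exec (Load x y) s t s'" "exec (Store x y) s t s'" "exec Skip s t s'"
  "exec (Seq p q) s t s'" "exec (IfLess x y p q) s t s'"

lemma wp_simps [simp]:
  "wp (Const x c) Q (R, m) \<longleftrightarrow> Q 1 (R(x := c), m)"
  "wp (Copy x y) Q (R, m) \<longleftrightarrow> Q 1 (R(x := R y), m)"
  "wp (Plus x y z) Q (R, m) \<longleftrightarrow> Q 1 (R(x := R y + R z), m)"
  "wp (Load x y) Q (R, m) \<longleftrightarrow> Q 1 (R(x := m (R y)), m)"
  "wp (Store x y) Q (R, m) \<longleftrightarrow> Q 1 (R, m(R x := R y))"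
  "wp Skip Q s \<longleftrightarrow> Q 1 s"
  "wp (Seq p q) Q s \<longleftrightarrow> wp p (\<lambda>t. wp q (\<lambda>u. Q (t + u))) s"
  unfolding wp_def by (auto simp: exec_iffs) blast+

lemma wp_IfLess [simp]:
  "wp (IfLess x y p q) Q s \<longleftrightarrow>
     (if fst s x < fst s y then wp p (\<lambda>t. Q (1 + t)) s else wp q (\<lambda>t. Q (1 + t)) s)"
  unfolding wp_def by (auto simp: exec_iffs)

lemma wp_mono: "wp p Q s \<Longrightarrow> (\<And>t s'. Q t s' \<Longrightarrow> Q' t s') \<Longrightarrow> wp p Q' s"
  unfolding wp_def by blast

text \<open>For loops of exactly \<open>n\<close> rounds: \<open>I i\<close> holds after
  \<open>i\<close> rounds, a round costs at most \<open>T\<close> plus one test, and the final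
  \<open>1\<close> is the failing test.\<close>

lemma wp_for:
  assumes step: "\<And>i R m. i < n \<Longrightarrow> I i R m \<Longrightarrow>
      R x < R y \<and> wp p (\<lambda>t s. t \<le> T \<and> I (Suc i) (fst s) (snd s)) (R, m)"
    and exit: "\<And>R m. I n R m \<Longrightarrow> \<not> R x < R y"
    and init: "I 0 R m"
    and post: "\<And>t R m. t \<le> n * (T + 1) + 1 \<Longrightarrow> I n R m \<Longrightarrow> Q t (R, m)"
  shows "wp (WhileLess x y p) Q (R, m)"
proof -
  \<comment> \<open>Induction on the number \<open>d\<close> of rounds left, since
    \<open>WhileTrue\<close> peels off the first round.\<close>
  have "wp (WhileLess x y p) (\<lambda>t s. t \<le> d * (T + 1) + 1 \<and> I n (fst s) (snd s)) (R, m)"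
    if "I (n - d) R m" "d \<le> n" for d R m
    using that
  proof (induction d arbitrary: R m)
    case 0
    then show ?case using exit[of R m] WhileFalse[of "(R, m)" x y p] unfolding wp_def by force
  next
    case (Suc d)
    from Suc.prems step[of "n - Suc d" R m] obtain t R' m' where
      1: "R x < R y" "exec p (R, m) t (R', m')" "t \<le> T" "I (n - d) R' m'"
      unfolding wp_def by (auto simp: Suc_diff_Suc)
    from Suc.IH[OF 1(4)] Suc.prems obtain u s' where
      2: "exec (WhileLess x y p) (R', m') u s'" "u \<le> d * (T + 1) + 1" "I n (fst s') (snd s')"
      unfolding wp_def by auto
    have "exec (WhileLess x y p) (R, m) (1 + t + u) s'"
      using WhileTrue[OF _ 1(2) 2(1)] 1(1) by simp
    then show ?case using 1(3) 2 unfolding wp_def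
      by (intro exI[of _ "1 + t + u"] exI[of _ s']) simp
  qed
  from this[of n] init
  have "wp (WhileLess x y p) (\<lambda>t s. t \<le> n * (T + 1) + 1 \<and> I n (fst s) (snd s)) (R, m)"
    by simp
  then show ?thesis
    by (rule wp_mono) (metis post prod.collapse)
qed

section \<open>The program\<close>

definition cnt :: "nat mat \<Rightarrow> nat \<Rightarrow> nat \<Rightarrow> nat" where
  "cnt M i j = (\<Sum>l<j. M $$ (i, l))"

text \<open>
  \<open>bucket n M (Suc j) x\<close> is the number of travellers who cycle stage \<open>j\<close> after exactly \<open>x\<close> earlier
  cycled stages. The shift by one makes room for an empty stage in front of stage \<open>0\<close>, so that the
  program need not treat the first post specially. It keeps \<open>bucket n M j x\<close> at address
  \<open>n * n + j * n + x\<close>, behind the matrix.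
\<close>

definition hit :: "nat mat \<Rightarrow> nat \<Rightarrow> nat \<Rightarrow> nat \<Rightarrow> nat" where
  "hit M i j x = (if cnt M i j = x then M $$ (i, j) else 0)"

definition bucket :: "nat \<Rightarrow> nat mat \<Rightarrow> nat \<Rightarrow> nat \<Rightarrow> nat" where
  "bucket n M j x = (case j of 0 \<Rightarrow> 0 | Suc j' \<Rightarrow> \<Sum>i<n. hit M i j' x)"

text \<open>
  The cyclists of the preceding stage counted on the left have one more cycled stage when they
  hand over their bicycles, whence the shift from \<open>x\<close> to \<open>Suc x\<close>.
\<close>

definition column_ok :: "nat \<Rightarrow> nat mat \<Rightarrow> nat \<Rightarrow> bool" where
  "column_ok n M j \<longleftrightarrow>
     (\<forall>x<n. (\<Sum>y<x. bucket n M j y) \<le> (\<Sum>y<Suc x. bucket n M (Suc j) y)) \<and>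
     (\<Sum>y<n. bucket n M (Suc j) y) = cnt M 0 n"

text \<open>The sum of row \<open>0\<close> is the only candidate for \<open>k\<close>; column sums
  are compared with it inside \<open>column_ok\<close>, as bucket totals.\<close>

definition criterion :: "nat \<Rightarrow> nat mat \<Rightarrow> bool" where
  "criterion n M \<longleftrightarrow> (\<forall>i<n. cnt M i n = cnt M 0 n) \<and> (\<forall>j<n. column_ok n M j)"

text \<open>
  Registers: \<open>0\<close> holds \<open>n\<close>, \<open>1\<close> the constant \<open>1\<close>, \<open>2\<close> the address of \<open>bucket n M 1 0\<close>, \<open>3\<close> the sum
  of row \<open>0\<close>, \<open>4\<close> and \<open>8\<close> the outer and inner loop counters, \<open>5\<close> and \<open>6\<close> memory pointers, \<open>7\<close> and
  \<open>10\<close> running sums (\<open>10\<close> also a bucket value), \<open>9\<close> the entry just read, \<open>11\<close> the verdict.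
\<close>

notation Seq (infixr ";;" 60)

text \<open>The machine tests only \<open><\<close>, so disequality takes two tests. The verdict
  starts at \<open>1\<close> and is afterwards only ever set to \<open>0\<close>, which makes it a
  conjunction.\<close>

definition fail_neq :: "nat \<Rightarrow> nat \<Rightarrow> prog" where
  "fail_neq x y = IfLess x y (Const 11 0) (IfLess y x (Const 11 0) Skip)"

text \<open>For lack of multiplication, \<open>n * n + n\<close> is built by repeated addition, in
  the loop that sums row \<open>0\<close>. That row lies at addresses \<open>0\<close> to
  \<open>n - 1\<close>, so the counter doubles as pointer.\<close>

definition setup_prog :: prog where
  "setup_prog = Const 1 1 ;; Copy 2 0 ;; Const 11 1 ;;
     WhileLess 4 0 (Plus 2 2 0 ;; Load 9 4 ;; Plus 3 3 9 ;; Plus 4 4 1)"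

text \<open>Register \<open>6\<close> points at the cell for the current stage and count. Adding the
  entry itself avoids a branch: a walker adds \<open>0\<close>. Then the entry advances the count
  and \<open>n\<close> advances the stage.\<close>

definition row_loop :: prog where
  "row_loop = WhileLess 8 0 (Load 9 5 ;; Load 10 6 ;; Plus 10 10 9 ;; Store 6 10 ;;
     Plus 6 6 9 ;; Plus 7 7 9 ;; Plus 6 6 0 ;; Plus 5 5 1 ;; Plus 8 8 1)"

definition rows_prog :: prog where
  "rows_prog = Const 4 0 ;;
     WhileLess 4 0 (Copy 6 2 ;; Const 7 0 ;; Const 8 0 ;; row_loop ;; fail_neq 7 3 ;; Plus 4 4 1)"

text \<open>The right sum grows before the comparison and the left one after it, which yields the
  bounds \<open>Suc x\<close> and \<open>x\<close> of \<open>column_ok\<close>.\<close>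

definition column_loop :: prog where
  "column_loop = WhileLess 8 0 (Load 9 6 ;; Plus 10 10 9 ;; IfLess 10 7 (Const 11 0) Skip ;;
     Load 9 5 ;; Plus 7 7 9 ;; Plus 5 5 1 ;; Plus 6 6 1 ;; Plus 8 8 1)"

text \<open>Register \<open>5\<close>, left at \<open>n * n\<close> by \<open>rows_prog\<close>,
  points at the row of the empty stage and stays one bucket row behind register
  \<open>6\<close>.\<close>

definition columns_prog :: prog where
  "columns_prog = Const 4 0 ;; Copy 6 2 ;;
     WhileLess 4 0
       (Const 7 0 ;; Const 10 0 ;; Const 8 0 ;; column_loop ;; fail_neq 10 3 ;; Plus 4 4 1)"

definition decide_prog :: prog where
  "decide_prog = setup_prog ;; rows_prog ;; columns_prog ;; Copy 0 11"

section \<open>Correctness and cost of the program\<close>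

definition matrix_in :: "nat \<Rightarrow> nat mat \<Rightarrow> (nat \<Rightarrow> nat) \<Rightarrow> bool" where
  "matrix_in n M m \<longleftrightarrow> (\<forall>i<n. \<forall>j<n. m (i * n + j) = M $$ (i, j))"

definition params :: "nat \<Rightarrow> nat mat \<Rightarrow> (nat \<Rightarrow> nat) \<Rightarrow> bool" where
  "params n M R \<longleftrightarrow> R 0 = n \<and> R 1 = 1 \<and> R 2 = n * n + n \<and> R 3 = cnt M 0 n"

lemma setup_prog_correct:
  assumes "n \<ge> 1"
  shows "wp setup_prog (\<lambda>t s. t \<le> 5 * n + 4 \<and> params n M (fst s) \<and> fst s 5 = 0 \<and> fst s 11 = 1 \<and>
     matrix_in n M (snd s) \<and> (\<forall>a\<ge>n * n. snd s a = 0)) (input_state n M)"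
proof -
  have mat: "matrix_in n M m" if "m = (\<lambda>a. if a < n * n then M $$ (a div n, a mod n) else 0)" for m
  proof -
    have "i * n + j < n * n" if "i < n" "j < n" for i j
    proof -
      have "Suc i * n \<le> n * n" using that by (intro mult_le_mono1) simp
      then show ?thesis using that by simp
    qed
    then show ?thesis using that by (auto simp: matrix_in_def)
  qed
  show ?thesis
    unfolding setup_prog_def input_state_def
    apply simp
    \<comment> \<open>Four instructions and a test make \<open>5\<close> per round; three
      assignments and the failing test make the \<open>4\<close> of the bound.\<close>
    apply (rule wp_for[where n = n and T = 4 and I = "\<lambda>i R m. R 0 = n \<and> R 1 = 1 \<and> R 2 = n + i * n \<and>
        R 3 = cnt M 0 i \<and> R 4 = i \<and> R 5 = 0 \<and> R 11 = 1 \<and> matrix_in n M m \<and> (\<forall>a\<ge>n * n. m a = 0)"])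
    subgoal for i R m using assms
      by (auto simp: cnt_def matrix_in_def dest: spec[of _ 0])
    subgoal by simp
    subgoal by (simp add: cnt_def mat)
    subgoal by (simp add: params_def)
    done
qed

text \<open>Uniqueness of quotient and remainder; it keeps bucket cells from sharing an
  address.\<close>

lemma cell_eq_iff:
  fixes n :: nat
  assumes "x < n" "x' < n"
  shows "j * n + x = j' * n + x' \<longleftrightarrow> j = j' \<and> x = x'"
proof
  assume eq: "j * n + x = j' * n + x'"
  have "(j * n + x) div n = j" "(j' * n + x') div n = j'"
    "(j * n + x) mod n = x" "(j' * n + x') mod n = x'"
    using assms by auto
  then show "j = j' \<and> x = x'" using eq by metis
qed simp

lemma binary_matD:
  assumes "binary_mat n M" "i < n" "j < n"
  shows "M $$ (i, j) = 0 \<or> M $$ (i, j) = 1"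
proof -
  have "M \<in> carrier_mat n n" "elements_mat M \<subseteq> {0, 1}"
    using assms(1) by (simp_all add: binary_mat_def)
  then show ?thesis using elements_matI[OF _ assms(2,3) refl, of M] by blast
qed

lemma cnt_le:
  assumes "binary_mat n M" "i < n" "j \<le> n"
  shows "cnt M i j \<le> j"
proof -
  have "M $$ (i, l) \<le> 1" if "l < j" for l
    using binary_matD[OF assms(1,2), of l] assms(3) that by fastforce
  then have "cnt M i j \<le> (\<Sum>l<j. 1)" unfolding cnt_def by (intro sum_mono) auto
  then show ?thesis by simp
qed

text \<open>The half-built table: travellers before \<open>i\<close> are entered completely,
  traveller \<open>i\<close> up to stage \<open>j\<close>. The first conjunct keeps the row of the
  empty stage clear.\<close>

definition filled :: "nat \<Rightarrow> nat mat \<Rightarrow> nat \<Rightarrow> nat \<Rightarrow> (nat \<Rightarrow> nat) \<Rightarrow> bool" where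
  "filled n M i j m \<longleftrightarrow> (\<forall>x<n. m (n * n + x) = 0) \<and> (\<forall>j'<n. \<forall>x<n.
     m (n * n + n + j' * n + x) = (\<Sum>i'<i. hit M i' j' x) + (if j' < j then hit M i j' x else 0))"

text \<open>At stage \<open>j\<close>, \<open>hit\<close> vanishes except at the current count, and
  by \<open>cell_eq_iff\<close> the write touches only that cell.\<close>

lemma filled_step:
  assumes "filled n M i j m" "j < n" "c = cnt M i j" "c < n"
  shows "filled n M i (Suc j)
    (m(n * n + n + j * n + c := m (n * n + n + j * n + c) + M $$ (i, j)))"
proof -
  have "n * n + n + j' * n + x = n * n + n + j * n + c \<longleftrightarrow> j' = j \<and> x = c" if "x < n" for j' x
    using cell_eq_iff[OF that assms(4), of j' j] by linarith
  then show ?thesis using assms by (auto simp: filled_def hit_def less_Suc_eq)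
qed

lemma matrix_in_upd:
  assumes "matrix_in n M m" "a \<ge> n * n"
  shows "matrix_in n M (m(a := z))"
proof -
  have "i * n + j \<noteq> a" if "i < n" "j < n" for i j
  proof -
    have "Suc i * n \<le> n * n" using that by (intro mult_le_mono1) simp
    then show ?thesis using that assms(2) by simp
  qed
  then show ?thesis using assms by (auto simp: matrix_in_def)
qed

text \<open>The postcondition \<open>Q\<close> is arbitrary so that the rule chains with the code
  after the loop.\<close>

lemma row_loop_correct:
  assumes M: "binary_mat n M" and i: "i < n"
    and init: "params n M R" "matrix_in n M m" "filled n M i 0 m" "R 4 = i" "R 5 = i * n"
      "R 6 = n * n + n" "R 7 = 0" "R 8 = 0" "R 11 = g"
    and post: "\<And>t R m. t \<le> 10 * n + 1 \<Longrightarrow> params n M R \<Longrightarrow> matrix_in n M m \<Longrightarrow> filled n M i n m \<Longrightarrow>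
      R 4 = i \<Longrightarrow> R 5 = Suc i * n \<Longrightarrow> R 7 = cnt M i n \<Longrightarrow> R 11 = g \<Longrightarrow> Q t (R, m)"
  shows "wp row_loop Q (R, m)"
  unfolding row_loop_def
proof (rule wp_for[where n = n and T = 9 and I = "\<lambda>j R m. params n M R \<and> matrix_in n M m \<and>
      filled n M i j m \<and> R 4 = i \<and> R 5 = i * n + j \<and> R 6 = n * n + n + j * n + cnt M i j \<and>
      R 7 = cnt M i j \<and> R 8 = j \<and> R 11 = g"], goal_cases)
  case (1 j R m)
  \<comment> \<open>At most \<open>j\<close> stages were cycled before stage \<open>j\<close>, so
    the pointer stays within its bucket row.\<close>
  have c: "cnt M i j < n" using cnt_le[OF M i, of j] 1 by simp
  have e: "m (i * n + j) = M $$ (i, j)" using 1 i by (simp add: matrix_in_def)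
  show ?case
    using 1 c e filled_step[of n M i j m "cnt M i j"]
    by (simp add: params_def matrix_in_upd cnt_def)
next
  case (2 R m)
  then show ?case by (simp add: params_def)
next
  case 3
  then show ?case using init by (simp add: cnt_def)
next
  case (4 t R m)
  then show ?case by (intro post) simp_all
qed

lemma rows_prog_step:
  assumes M: "binary_mat n M" and i: "i < n"
    and init: "params n M R" "matrix_in n M m" "filled n M i 0 m" "R 4 = i" "R 5 = i * n" "R 11 = g"
  shows "wp (Copy 6 2 ;; Const 7 0 ;; Const 8 0 ;; row_loop ;; fail_neq 7 3 ;; Plus 4 4 1)
    (\<lambda>t s. t \<le> 10 * n + 8 \<and> params n M (fst s) \<and> matrix_in n M (snd s) \<and>
      filled n M (Suc i) 0 (snd s) \<and> fst s 4 = Suc i \<and> fst s 5 = Suc i * n \<and>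
      fst s 11 = (if cnt M i n = cnt M 0 n then g else 0)) (R, m)"
  \<comment> \<open>The bound adds three assignments, the loop, at most three units for
    \<open>fail_neq\<close> and one for the increment.\<close>
  unfolding wp_simps(1,2,7)
proof (rule row_loop_correct[OF M i, where g = g], goal_cases)
  case (10 t R m)
  then have "filled n M (Suc i) 0 m" by (auto simp: filled_def)
  with 10 show ?case by (auto simp: fail_neq_def params_def)
qed (use init in \<open>simp_all add: params_def\<close>)

lemma rows_prog_correct:
  assumes M: "binary_mat n M"
    and init: "params n M R" "matrix_in n M m" "\<forall>a\<ge>n * n. m a = 0" "R 5 = 0" "R 11 = 1"
    and post: "\<And>t R m. t \<le> n * (9 + 10 * n) + 2 \<Longrightarrow> params n M R \<Longrightarrow> R 5 = n * n \<Longrightarrow>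
      (\<And>j x. j \<le> n \<Longrightarrow> x < n \<Longrightarrow> m (n * n + j * n + x) = bucket n M j x) \<Longrightarrow>
      R 11 = of_bool (\<forall>i<n. cnt M i n = cnt M 0 n) \<Longrightarrow> Q t (R, m)"
  shows "wp rows_prog Q (R, m)"
  unfolding rows_prog_def wp_simps(1,7)
proof (rule wp_for[where n = n and T = "10 * n + 8" and I = "\<lambda>i R m. params n M R \<and>
      matrix_in n M m \<and> filled n M i 0 m \<and> R 4 = i \<and> R 5 = i * n \<and>
      R 11 = of_bool (\<forall>i'<i. cnt M i' n = cnt M 0 n)"], goal_cases)
  case (1 i R m)
  let ?g = "of_bool (\<forall>i'<i. cnt M i' n = cnt M 0 n) :: nat"
  have "wp (Copy 6 2 ;; Const 7 0 ;; Const 8 0 ;; row_loop ;; fail_neq 7 3 ;; Plus 4 4 1)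
    (\<lambda>t s. t \<le> 10 * n + 8 \<and> params n M (fst s) \<and> matrix_in n M (snd s) \<and>
      filled n M (Suc i) 0 (snd s) \<and> fst s 4 = Suc i \<and> fst s 5 = Suc i * n \<and>
      fst s 11 = (if cnt M i n = cnt M 0 n then ?g else 0)) (R, m)"
    using 1 by (intro rows_prog_step[OF M]) simp_all
  moreover have "(if cnt M i n = cnt M 0 n then ?g else 0) =
      of_bool (\<forall>i'<Suc i. cnt M i' n = cnt M 0 n)"
    by (auto simp: less_Suc_eq)
  moreover have "R 4 < R 0"
    using 1 by (simp add: params_def)
  ultimately show ?case by simp
next
  case (2 R m)
  then show ?case by (simp add: params_def)
next
  case 3
  have "m (n * n + n + j * n + x) = 0" for j x by (rule init(3)[rule_format]) simp
  then show ?case using init by (simp add: params_def filled_def)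
next
  case (4 t R m)
  have "m (n * n + j * n + x) = bucket n M j x" if "j \<le> n" "x < n" for j x
  proof (cases j)
    case 0
    then show ?thesis using 4 that by (simp add: filled_def bucket_def)
  next
    case (Suc j')
    have "m (n * n + n + j' * n + x) = (\<Sum>i<n. hit M i j' x)"
      using 4 that Suc by (simp add: filled_def)
    then show ?thesis using Suc by (simp add: bucket_def add.assoc)
  qed
  with 4 show ?case by (intro post) simp_all
qed

lemma column_loop_correct:
  assumes j: "j < n"
    and mem: "\<And>j x. j \<le> n \<Longrightarrow> x < n \<Longrightarrow> m (n * n + j * n + x) = bucket n M j x"
    and init: "params n M R" "R 4 = j" "R 5 = n * n + j * n"
      "R 6 = n * n + Suc j * n" "R 7 = 0" "R 8 = 0" "R 10 = 0" "R 11 = of_bool g"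
    and post: "\<And>t R. t \<le> 10 * n + 1 \<Longrightarrow> params n M R \<Longrightarrow>
      R 4 = j \<Longrightarrow> R 5 = n * n + Suc j * n \<Longrightarrow> R 6 = n * n + Suc (Suc j) * n \<Longrightarrow>
      R 10 = (\<Sum>y<n. bucket n M (Suc j) y) \<Longrightarrow>
      R 11 = of_bool (g \<and>
        (\<forall>x<n. (\<Sum>y<x. bucket n M j y) \<le> (\<Sum>y<Suc x. bucket n M (Suc j) y))) \<Longrightarrow> Q t (R, m)"
  shows "wp column_loop Q (R, m)"
  unfolding column_loop_def
\<comment> \<open>\<open>T = 9\<close>: the conditional costs two units on either branch, the seven
  other instructions one each.\<close>
proof (rule wp_for[where n = n and T = 9 and I = "\<lambda>x R m'. m' = m \<and> params n M R \<and>
      R 4 = j \<and> R 5 = n * n + j * n + x \<and> R 6 = n * n + Suc j * n + x \<and>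
      R 7 = (\<Sum>y<x. bucket n M j y) \<and> R 8 = x \<and> R 10 = (\<Sum>y<x. bucket n M (Suc j) y) \<and>
      R 11 = of_bool (g \<and>
        (\<forall>x'<x. (\<Sum>y<x'. bucket n M j y) \<le> (\<Sum>y<Suc x'. bucket n M (Suc j) y)))"], goal_cases)
  case (1 x R m')
  have e: "m (n * n + j * n + x) = bucket n M j x"
    "m (n * n + (n + j * n) + x) = bucket n M (Suc j) x"
    using mem[of j x] mem[of "Suc j" x] 1 j by simp_all
  show ?case
    using 1 e by (auto simp: params_def less_Suc_eq not_less)
next
  case (2 R m)
  then show ?case by (simp add: params_def)
next
  case 3
  then show ?case using init by simp
next
  case (4 t R m)
  then show ?case by (auto intro!: post)
qed

lemma columns_prog_step:
  assumes j: "j < n"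
    and mem: "\<And>j x. j \<le> n \<Longrightarrow> x < n \<Longrightarrow> m (n * n + j * n + x) = bucket n M j x"
    and init: "params n M R" "R 4 = j" "R 5 = n * n + j * n"
      "R 6 = n * n + Suc j * n" "R 11 = of_bool g"
  shows "wp (Const 7 0 ;; Const 10 0 ;; Const 8 0 ;; column_loop ;; fail_neq 10 3 ;; Plus 4 4 1)
    (\<lambda>t s. t \<le> 10 * n + 8 \<and> snd s = m \<and> params n M (fst s) \<and> fst s 4 = Suc j \<and>
      fst s 5 = n * n + Suc j * n \<and> fst s 6 = n * n + Suc (Suc j) * n \<and>
      fst s 11 = of_bool (g \<and> column_ok n M j)) (R, m)"
  unfolding wp_simps(1,2,7)
proof (rule column_loop_correct[OF j mem, where g = g], goal_cases)
  case (11 t R)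
  then show ?case by (auto simp: fail_neq_def params_def column_ok_def simp del: sum.lessThan_Suc)
qed (use init in \<open>simp_all add: params_def\<close>)

lemma columns_prog_correct:
  assumes mem: "\<And>j x. j \<le> n \<Longrightarrow> x < n \<Longrightarrow> m (n * n + j * n + x) = bucket n M j x"
    and init: "params n M R" "R 5 = n * n" "R 11 = of_bool (\<forall>i<n. cnt M i n = cnt M 0 n)"
    and post: "\<And>t R m. t \<le> n * (9 + 10 * n) + 3 \<Longrightarrow> R 11 = of_bool (criterion n M) \<Longrightarrow> Q t (R, m)"
  shows "wp columns_prog Q (R, m)"
  unfolding columns_prog_def wp_simps(1,2,7)
proof (rule wp_for[where n = n and T = "10 * n + 8" and I = "\<lambda>j R m'. m' = m \<and> params n M R \<and>
      R 4 = j \<and> R 5 = n * n + j * n \<and> R 6 = n * n + Suc j * n \<and>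
      R 11 = of_bool ((\<forall>i<n. cnt M i n = cnt M 0 n) \<and> (\<forall>j'<j. column_ok n M j'))"], goal_cases)
  case (1 j R m')
  let ?g = "(\<forall>i<n. cnt M i n = cnt M 0 n) \<and> (\<forall>j'<j. column_ok n M j')"
  have "wp (Const 7 0 ;; Const 10 0 ;; Const 8 0 ;; column_loop ;; fail_neq 10 3 ;; Plus 4 4 1)
    (\<lambda>t s. t \<le> 10 * n + 8 \<and> snd s = m \<and> params n M (fst s) \<and> fst s 4 = Suc j \<and>
      fst s 5 = n * n + Suc j * n \<and> fst s 6 = n * n + Suc (Suc j) * n \<and>
      fst s 11 = of_bool (?g \<and> column_ok n M j)) (R, m)"
    using 1 by (intro columns_prog_step mem) simp_all
  moreover have "?g \<and> column_ok n M j \<longleftrightarrow>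
      (\<forall>i<n. cnt M i n = cnt M 0 n) \<and> (\<forall>j'<Suc j. column_ok n M j')"
    by (auto simp: less_Suc_eq)
  moreover have "R 4 < R 0" "m' = m"
    using 1 by (simp_all add: params_def)
  ultimately show ?case by simp
next
  case (2 R m)
  then show ?case by (simp add: params_def)
next
  case 3
  then show ?case using init by (simp add: params_def)
next
  case (4 t R m')
  then show ?case by (intro post) (simp_all add: criterion_def)
qed

lemma decide_prog_correct:
  assumes "n \<ge> 1" "binary_mat n M"
  shows "wp decide_prog (\<lambda>t s. t \<le> 60 * n\<^sup>2 \<and> answer s = of_bool (criterion n M)) (input_state n M)"
  unfolding decide_prog_def wp_simps(7)
proof (rule wp_mono[OF setup_prog_correct[OF assms(1), of M]])
  fix t s
  assume 1: "t \<le> 5 * n + 4 \<and> params n M (fst s) \<and> fst s 5 = 0 \<and> fst s 11 = 1 \<and>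
     matrix_in n M (snd s) \<and> (\<forall>a\<ge>n * n. snd s a = 0)"
  obtain R m where s: "s = (R, m)" by (cases s)
  have n: "n \<le> n * n" "1 \<le> n * n" using assms(1) by simp_all
  show "wp rows_prog (\<lambda>ta. wp columns_prog (\<lambda>tb. wp (Copy 0 11)
    (\<lambda>u s. t + (ta + (tb + u)) \<le> 60 * n\<^sup>2 \<and> answer s = of_bool (criterion n M)))) s"
    unfolding s
  proof (rule rows_prog_correct[OF assms(2)], goal_cases)
    case (6 ta R m)
    show ?case
    proof (rule columns_prog_correct[OF 6(4)], goal_cases)
      case (6 tb R m)
      have "t + (ta + (tb + 1)) \<le> 5 * n + 4 + (n * (9 + 10 * n) + 2) + (n * (9 + 10 * n) + 3) + 1"
        using 1 6 \<open>ta \<le> _\<close> by linarith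
      \<comment> \<open>The sum is \<open>20 * n * n + 23 * n + 10\<close>, at most
        \<open>53 * n * n\<close> for \<open>n \<ge> 1\<close>; \<open>60\<close> is a rounder
        constant.\<close>
      also have "\<dots> \<le> 60 * n\<^sup>2"
      proof -
        have "n * (9 + 10 * n) = 9 * n + 10 * (n * n)" by (simp add: algebra_simps)
        then show ?thesis unfolding power2_eq_square using n by linarith
      qed
      finally show ?case using 6 by (simp add: answer_def)
    qed (use 6 in simp_all)
  qed (use 1 s in simp_all)
qed

section \<open>The combinatorial characterization of optimal matrices\<close>

definition cyclists :: "nat \<Rightarrow> nat mat \<Rightarrow> nat \<Rightarrow> nat set" where
  "cyclists n M j = {i. i < n \<and> M $$ (i, j) = 1}"

text \<open>Hall's condition for passing on bicycles at post \<open>Suc j\<close>: a smaller count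
  means a later arrival, and a bicycle can only go to somebody at least as late. Admissible sets are
  nested, so thresholds \<open>x\<close> suffice.\<close>

definition handover :: "nat \<Rightarrow> nat mat \<Rightarrow> nat \<Rightarrow> bool" where
  "handover n M j \<longleftrightarrow> (\<forall>x. card {i \<in> cyclists n M j. cnt M i (Suc j) \<le> x}
     \<le> card {i \<in> cyclists n M (Suc j). cnt M i (Suc j) \<le> x})"

lemma finite_cyclists [simp]: "finite (cyclists n M j)"
  by (simp add: cyclists_def)

lemma cnt_Suc: "cnt M i (Suc j) = cnt M i j + M $$ (i, j)"
  by (simp add: cnt_def)

lemma sum_eq_card:
  fixes f :: "nat \<Rightarrow> nat"
  assumes "\<And>i. i < n \<Longrightarrow> f i = of_bool (P i)"
  shows "(\<Sum>i<n. f i) = card {i. i < n \<and> P i}"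
proof -
  have "(\<Sum>i<n. f i) = (\<Sum>i<n. of_bool (P i))" using assms by simp
  also have "\<dots> = card ({..<n} \<inter> {i. P i})" by (simp add: sum_of_bool_eq)
  also have "{..<n} \<inter> {i. P i} = {i. i < n \<and> P i}" by auto
  finally show ?thesis .
qed

lemma cnt_eq_card:
  assumes "binary_mat n M" "i < n"
  shows "cnt M i n = card {j. j < n \<and> M $$ (i, j) = 1}"
  unfolding cnt_def using binary_matD[OF assms] by (intro sum_eq_card) fastforce

text \<open>After exchanging the sums, a cyclist contributes only at \<open>y = cnt M i j\<close>,
  hence once iff this is below \<open>x\<close>.\<close>

lemma sum_bucket:
  assumes "binary_mat n M" "j < n"
  shows "(\<Sum>y<x. bucket n M (Suc j) y) = card {i \<in> cyclists n M j. cnt M i j < x}"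
proof -
  have "(\<Sum>y<x. bucket n M (Suc j) y) = (\<Sum>i<n. \<Sum>y<x. hit M i j y)"
    unfolding bucket_def by (simp add: sum.swap[of _ "{..<n}"])
  also have "\<dots> = card {i. i < n \<and> (M $$ (i, j) = 1 \<and> cnt M i j < x)}"
    unfolding hit_def using binary_matD[OF assms(1) _ assms(2)]
    by (intro sum_eq_card) (fastforce simp: sum.delta')
  finally show ?thesis by (simp add: cyclists_def conj_assoc)
qed

lemma criterion_iff:
  assumes n: "n \<ge> 1" and M: "binary_mat n M"
  shows "criterion n M \<longleftrightarrow> (\<exists>k. k_uniform n k M) \<and> (\<forall>j. Suc j < n \<longrightarrow> handover n M j)"
proof -
  have cnt_less: "cnt M i j < n" if "i < n" "j < n" for i j
    using cnt_le[OF M that(1), of j] that by simp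
  have col: "(\<Sum>y<n. bucket n M (Suc j) y) = card (cyclists n M j)" if "j < n" for j
  proof -
    have "{i \<in> cyclists n M j. cnt M i j < n} = cyclists n M j"
      using cnt_less that by (auto simp: cyclists_def)
    then show ?thesis using sum_bucket[OF M that] by simp
  qed
  have ku: "k_uniform n k M \<longleftrightarrow> (\<forall>i<n. cnt M i n = k) \<and> (\<forall>j<n. card (cyclists n M j) = k)" for k
    by (simp add: k_uniform_def cnt_eq_card[OF M] cyclists_def)
  have uniform: "(\<exists>k. k_uniform n k M) \<longleftrightarrow> (\<forall>i<n. cnt M i n = cnt M 0 n) \<and>
      (\<forall>j<n. card (cyclists n M j) = cnt M 0 n)"
  proof (intro iffI)
    assume "\<exists>k. k_uniform n k M"
    then obtain k where k: "k_uniform n k M" by blast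
    then have "cnt M 0 n = k" using n by (simp add: ku)
    with k show "(\<forall>i<n. cnt M i n = cnt M 0 n) \<and> (\<forall>j<n. card (cyclists n M j) = cnt M 0 n)"
      unfolding ku by blast
  qed (use ku in blast)
  have hand: "handover n M j \<longleftrightarrow> (\<forall>x<n. (\<Sum>y<x. bucket n M (Suc j) y)
      \<le> (\<Sum>y<Suc x. bucket n M (Suc (Suc j)) y))"
    if j: "Suc j < n" and card: "card (cyclists n M j) = card (cyclists n M (Suc j))" for j
  proof -
    \<comment> \<open>A cyclist of stage \<open>j\<close> gains one there, so fewer than
      \<open>x\<close> before it means at most \<open>x\<close> after it.\<close>
    have "(\<Sum>y<x. bucket n M (Suc j) y) = card {i \<in> cyclists n M j. cnt M i (Suc j) \<le> x}" for x
      using j by (subst sum_bucket[OF M]) (auto simp: cyclists_def cnt_Suc intro!: arg_cong[of _ _ card])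
    moreover have "(\<Sum>y<Suc x. bucket n M (Suc (Suc j)) y) =
        card {i \<in> cyclists n M (Suc j). cnt M i (Suc j) \<le> x}" for x
      using j by (subst sum_bucket[OF M]) (auto simp: less_Suc_eq_le)
    moreover have "handover n M j \<longleftrightarrow> (\<forall>x<n. card {i \<in> cyclists n M j. cnt M i (Suc j) \<le> x}
        \<le> card {i \<in> cyclists n M (Suc j). cnt M i (Suc j) \<le> x})"
    proof -
      \<comment> \<open>For \<open>x \<ge> n\<close> both sets are whole columns, of equal size; the
        program may stop at \<open>x < n\<close>.\<close>
      have "card {i \<in> cyclists n M j. cnt M i (Suc j) \<le> x}
          \<le> card {i \<in> cyclists n M (Suc j). cnt M i (Suc j) \<le> x}" if "x \<ge> n" for x
      proof -
        have "cnt M i (Suc j) \<le> x" if "i < n" for i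
          using cnt_less[OF that j] \<open>x \<ge> n\<close> by simp
        then have "{i \<in> cyclists n M j'. cnt M i (Suc j) \<le> x} = cyclists n M j'" for j'
          by (auto simp: cyclists_def)
        then show ?thesis using card by simp
      qed
      then show ?thesis unfolding handover_def by (meson linorder_not_less)
    qed
    ultimately show ?thesis by (simp del: sum.lessThan_Suc)
  qed
  \<comment> \<open>The empty stage makes the inequality at the first post trivial, leaving those at
    \<open>Suc j\<close>.\<close>
  have first: "(\<Sum>y<x. bucket n M 0 y) = 0" for x by (simp add: bucket_def)
  have "(\<forall>j<n. \<forall>x<n. (\<Sum>y<x. bucket n M j y) \<le> (\<Sum>y<Suc x. bucket n M (Suc j) y)) \<longleftrightarrow>
      (\<forall>j. Suc j < n \<longrightarrow> handover n M j)"
    if "\<forall>j<n. card (cyclists n M j) = cnt M 0 n"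
  proof -
    have "(\<forall>j<n. Q j) \<longleftrightarrow> (\<forall>j. Suc j < n \<longrightarrow> Q (Suc j))" if "Q 0" for Q
    proof (intro iffI allI impI)
      fix j
      assume "\<forall>j. Suc j < n \<longrightarrow> Q (Suc j)" "j < n"
      then show "Q j" using that by (cases j) simp_all
    qed simp
    from this[of "\<lambda>j. \<forall>x<n. (\<Sum>y<x. bucket n M j y) \<le> (\<Sum>y<Suc x. bucket n M (Suc j) y)"]
    show ?thesis using hand that by (simp add: first del: sum.lessThan_Suc)
  qed
  moreover have "column_ok n M j \<longleftrightarrow>
      (\<forall>x<n. (\<Sum>y<x. bucket n M j y) \<le> (\<Sum>y<Suc x. bucket n M (Suc j) y)) \<and>
      card (cyclists n M j) = cnt M 0 n" if "j < n" for j
    by (simp only: column_ok_def col[OF that])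
  ultimately show ?thesis unfolding criterion_def uniform by blast
qed

text \<open>Hall's theorem for nested neighbourhoods, proved greedily: elements of \<open>A\<close>
  enter in order of increasing \<open>f\<close>, and each takes any admissible partner still
  free.\<close>

lemma injection_of_counts:
  fixes f :: "'a \<Rightarrow> 'c :: linorder" and g :: "'b \<Rightarrow> 'c"
  assumes "finite A" "finite B" "\<And>x. card {a \<in> A. f a \<le> x} \<le> card {b \<in> B. g b \<le> x}"
  shows "\<exists>\<psi>. inj_on \<psi> A \<and> (\<forall>a\<in>A. \<psi> a \<in> B \<and> g (\<psi> a) \<le> f a)"
  using assms(1,3)
proof (induction A rule: finite_ranking_induct[where f = f])
  case empty
  show ?case by simp
next
  case (insert a S)
  show ?case
  proof (cases "a \<in> S")
    case True
    then show ?thesis using insert by (simp add: insert_absorb)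
  next
    case False
    have "card {a' \<in> S. f a' \<le> x} \<le> card {b \<in> B. g b \<le> x}" for x
    proof -
      have "card {a' \<in> S. f a' \<le> x} \<le> card {a' \<in> insert a S. f a' \<le> x}"
        using insert(1) by (intro card_mono) auto
      then show ?thesis using insert.prems[of x] by linarith
    qed
    then obtain \<psi> where \<psi>: "inj_on \<psi> S" "\<forall>a\<in>S. \<psi> a \<in> B \<and> g (\<psi> a) \<le> f a"
      using insert.IH by blast
    \<comment> \<open>As \<open>f a\<close> is the largest value so far, the assumption at
      \<open>x = f a\<close> counts all of \<open>insert a S\<close>, one more than
      \<open>\<psi>\<close> can have used up.\<close>
    have "{a' \<in> insert a S. f a' \<le> f a} = insert a S" using insert(2) by auto
    then have "card (insert a S) \<le> card {b \<in> B. g b \<le> f a}" using insert.prems[of "f a"] by simp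
    then have "card (\<psi> ` S) < card {b \<in> B. g b \<le> f a}"
      using False insert(1) card_image_le[OF insert(1), of \<psi>] by simp
    then obtain b where b: "b \<in> B" "g b \<le> f a" "b \<notin> \<psi> ` S"
      using card_mono[of "\<psi> ` S" "{b \<in> B. g b \<le> f a}"] insert(1) by fastforce
    have "\<forall>a'\<in>insert a S. (\<psi>(a := b)) a' \<in> B \<and> g ((\<psi>(a := b)) a') \<le> f a'"
      using \<psi> b by auto
    moreover have "inj_on (\<psi>(a := b)) (insert a S)"
      using \<psi> b False by (auto simp: inj_on_def image_iff)
    ultimately show ?thesis by blast
  qed
qed

section \<open>Arrival times and their order\<close>

context
  fixes v w :: real and n :: nat and M :: "nat mat"
  assumes speeds: "0 < w" "w < v" and binary: "binary_mat n M"
begin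

lemma arrival_eq:
  assumes "i < n" "j \<le> n"
  shows "arrival v w M i j = real j / w - real (cnt M i j) * (1 / w - 1 / v)"
  using assms(2)
proof (induction j)
  case 0
  then show ?case by (simp add: arrival_def cnt_def)
next
  case (Suc j)
  have "arrival v w M i (Suc j) = arrival v w M i j + stage_time v w M i j"
    by (simp add: arrival_def)
  then show ?case
    using Suc binary_matD[OF binary assms(1), of j]
    by (auto simp: stage_time_def cnt_Suc algebra_simps add_divide_distrib)
qed

text \<open>Every cycled stage saves \<open>1 / w - 1 / v > 0\<close>, so the order of arrivals
  depends on the counts alone.\<close>

lemma arrival_le_iff:
  assumes "i < n" "i' < n" "j \<le> n"
  shows "arrival v w M i j \<le> arrival v w M i' j \<longleftrightarrow> cnt M i' j \<le> cnt M i j"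
proof -
  have "0 < 1 / w - 1 / v" using speeds by (simp add: field_simps)
  then show ?thesis using assms by (simp add: arrival_eq)
qed

lemma arrival_nonneg: "0 \<le> arrival v w M i j"
  using speeds by (auto simp: arrival_def stage_time_def intro!: sum_nonneg)

lemma arrival_Suc: "M $$ (i, j) = 1 \<Longrightarrow> arrival v w M i (Suc j) = arrival v w M i j + 1 / v"
  by (simp add: arrival_def stage_time_def)

subsection \<open>Necessity\<close>

context
  fixes k :: nat and b :: "nat \<Rightarrow> nat \<Rightarrow> nat" and pos :: "nat \<Rightarrow> real \<Rightarrow> real"
  assumes exe: "no_wait_execution v w n M k b pos"
begin

lemma ride_end: "(i, j) \<in> rides n M b c \<Longrightarrow> arrival v w M i j < arrival v w M i (Suc j)"
  using speeds by (simp add: rides_def arrival_Suc)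

text \<open>If two half-open, non-empty periods overlapped, the later start would lie in
  both.\<close>

lemma rides_apart:
  assumes "c < k" "(i, j) \<in> rides n M b c" "(i', j') \<in> rides n M b c" "(i, j) \<noteq> (i', j')"
    "arrival v w M i j \<le> arrival v w M i' j'"
  shows "arrival v w M i (Suc j) \<le> arrival v w M i' j'"
proof (rule ccontr)
  assume "\<not> ?thesis"
  then have "arrival v w M i' j' \<in> ride_period v w M (i, j) \<inter> ride_period v w M (i', j')"
    using assms(5) ride_end[OF assms(3)] by (simp add: ride_period_def)
  moreover have "disjoint_family_on (ride_period v w M) (rides n M b c)"
    using exe assms(1) unfolding no_wait_execution_def by blast
  ultimately show False using assms(2-4) unfolding disjoint_family_on_def by blast
qed

lemma ride_pos:
  assumes "c < k" "(i, j) \<in> rides n M b c"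
  shows "pos c (arrival v w M i j) = real j" "pos c (arrival v w M i (Suc j)) = real (Suc j)"
proof -
  have *: "\<forall>t \<in> {arrival v w M i j .. arrival v w M i (Suc j)}.
      pos c t = real j + v * (t - arrival v w M i j)"
    using exe assms unfolding no_wait_execution_def by blast
  show "pos c (arrival v w M i j) = real j"
    using *[rule_format, of "arrival v w M i j"] ride_end[OF assms(2)] by simp
  have "M $$ (i, j) = 1" using assms(2) by (simp add: rides_def)
  then show "pos c (arrival v w M i (Suc j)) = real (Suc j)"
    using *[rule_format, of "arrival v w M i (Suc j)"] ride_end[OF assms(2)] speeds
    by (simp add: arrival_Suc)
qed

lemma pos_rest:
  assumes "c < k" "0 \<le> s" "s \<le> t" "\<And>r. r \<in> rides n M b c \<Longrightarrow> ride_period v w M r \<inter> {s..<t} = {}"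
  shows "pos c s = pos c t"
  using exe assms unfolding no_wait_execution_def by blast

lemma finite_rides: "finite (rides n M b c)"
  by (rule finite_subset[of _ "{..<n} \<times> {..<n}"]) (auto simp: rides_def)

text \<open>The bicycle rests between two consecutive rides, so these are on consecutive stages.\<close>

lemma previous_ride:
  assumes c: "c < k" and r: "(i, Suc j) \<in> rides n M b c"
  obtains i' where "(i', j) \<in> rides n M b c" "arrival v w M i' (Suc j) \<le> arrival v w M i (Suc j)"
    "\<And>p l. (p, l) \<in> rides n M b c \<Longrightarrow> arrival v w M p l < arrival v w M i (Suc j) \<Longrightarrow>
       arrival v w M p l \<le> arrival v w M i' j"
proof -
  let ?start = "\<lambda>(p, l). arrival v w M p l"
  let ?\<tau> = "arrival v w M i (Suc j)"
  define E where "E = {r \<in> rides n M b c. ?start r < ?\<tau>}"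
  have fin: "finite E" unfolding E_def using finite_rides by simp
  \<comment> \<open>Otherwise the bicycle would still be at position \<open>0\<close> at time
    \<open>?\<tau>\<close>, yet it is picked up at \<open>Suc j\<close>.\<close>
  have "E \<noteq> {}"
  proof
    assume empty: "E = {}"
    have "ride_period v w M r \<inter> {0..<?\<tau>} = {}" if "r \<in> rides n M b c" for r
      using that empty by (cases r) (fastforce simp: E_def ride_period_def)
    then have "pos c 0 = pos c ?\<tau>"
      using arrival_nonneg by (intro pos_rest[OF c]) auto
    moreover have "pos c 0 = 0" using exe c unfolding no_wait_execution_def by blast
    ultimately show False using ride_pos(1)[OF c r] by simp
  qed
  then have "Max (?start ` E) \<in> ?start ` E" using fin by simp
  then obtain p l where pl: "(p, l) \<in> E" "Max (?start ` E) = arrival v w M p l" by auto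
  have latest: "arrival v w M p' l' \<le> arrival v w M p l"
    if "(p', l') \<in> rides n M b c" "arrival v w M p' l' < ?\<tau>" for p' l'
  proof -
    have "?start (p', l') \<in> ?start ` E" using that by (intro imageI) (simp add: E_def)
    then have "?start (p', l') \<le> Max (?start ` E)" using fin by (intro Max_ge) auto
    then show ?thesis using pl(2) by simp
  qed
  have ride: "(p, l) \<in> rides n M b c" and before: "arrival v w M p l < ?\<tau>"
    using pl(1) by (auto simp: E_def)
  then have le: "arrival v w M p (Suc l) \<le> ?\<tau>"
    using rides_apart[OF c ride r] by fastforce
  \<comment> \<open>Any other ride begun before \<open>?\<tau>\<close> ends by the start of
    \<open>(p, l)\<close>, so the bicycle rests from the end of \<open>(p, l)\<close> until
    \<open>?\<tau>\<close>.\<close>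
  have "ride_period v w M (p', l') \<inter> {arrival v w M p (Suc l)..<?\<tau>} = {}"
    if ride': "(p', l') \<in> rides n M b c" for p' l'
  proof (cases "arrival v w M p' l' < ?\<tau>")
    case True
    have "arrival v w M p' (Suc l') \<le> arrival v w M p (Suc l)"
    proof (cases "(p', l') = (p, l)")
      case False
      then show ?thesis
        using rides_apart[OF c ride' ride False latest[OF ride' True]] ride_end[OF ride] by linarith
    qed simp
    then show ?thesis by (auto simp: ride_period_def)
  qed (auto simp: ride_period_def)
  then have "pos c (arrival v w M p (Suc l)) = pos c ?\<tau>"
    using arrival_nonneg le by (intro pos_rest[OF c]) auto
  then have "l = j" using ride_pos[OF c ride] ride_pos(1)[OF c r] by simp
  then show thesis using that[of p] ride le latest by blast
qed

text \<open>Rides on stage \<open>0\<close> all start at time \<open>0\<close> and would collide. Of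
  two rides on stage \<open>Suc j\<close>, the earlier starts after its predecessor on stage
  \<open>j\<close> has ended, and the later one's predecessor starts no sooner than that; by
  induction both predecessors coincide, which is absurd.\<close>

lemma rider_unique:
  assumes "c < k" "(i, j) \<in> rides n M b c" "(i', j) \<in> rides n M b c"
  shows "i = i'"
  using assms(2,3)
proof (induction j arbitrary: i i')
  case 0
  show ?case
  proof (rule ccontr)
    assume "i \<noteq> i'"
    then show False
      using rides_apart[OF assms(1) 0] ride_end[OF 0(1)] by (simp add: arrival_def)
  qed
next
  case (Suc j)
  have no_overtaking: False
    if r: "(i, Suc j) \<in> rides n M b c" "(i', Suc j) \<in> rides n M b c"
      and less: "arrival v w M i (Suc j) < arrival v w M i' (Suc j)" for i i'
  proof -
    obtain p where p: "(p, j) \<in> rides n M b c" "arrival v w M p (Suc j) \<le> arrival v w M i (Suc j)"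
      by (rule previous_ride[OF assms(1) r(1)]) blast
    obtain p' where p': "(p', j) \<in> rides n M b c"
      "arrival v w M i (Suc j) \<le> arrival v w M p' j"
      by (rule previous_ride[OF assms(1) r(2)]) (use r less in blast)
    have "p = p'" using Suc.IH p p' by blast
    then show False using p p' ride_end[OF p(1)] by simp
  qed
  show ?case
  proof (rule ccontr)
    assume ne: "i \<noteq> i'"
    have "arrival v w M i (Suc j) = arrival v w M i' (Suc j)"
      using no_overtaking[OF Suc.prems] no_overtaking[OF Suc.prems(2,1)]
      by (metis linorder_less_linear)
    then show False
      using rides_apart[OF assms(1) Suc.prems] ride_end[OF Suc.prems(1)] ne by simp
  qed
qed

text \<open>Each departing cyclist is sent to the one who brought his bicycle. This map is injective
  by \<open>rider_unique\<close>, hence surjective by equal column sizes, so every late arrival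
  serves somebody at least as late.\<close>

lemma handover_necessary:
  assumes j: "Suc j < n" and card: "card (cyclists n M j) = card (cyclists n M (Suc j))"
  shows "handover n M j"
proof -
  have ride: "(i, l) \<in> rides n M b (b i l)" "b i l < k" if "i \<in> cyclists n M l" "l < n" for i l
    using that exe by (auto simp: cyclists_def rides_def no_wait_execution_def)
  have "\<exists>p. (p, j) \<in> rides n M b (b i (Suc j)) \<and> arrival v w M p (Suc j) \<le> arrival v w M i (Suc j)"
    if i: "i \<in> cyclists n M (Suc j)" for i
    by (rule previous_ride[OF ride(2,1)[OF i j]]) blast
  then obtain g where g: "(g i, j) \<in> rides n M b (b i (Suc j))"
      "arrival v w M (g i) (Suc j) \<le> arrival v w M i (Suc j)"
    if "i \<in> cyclists n M (Suc j)" for i by metis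
  have g_in: "g i \<in> cyclists n M j" "b (g i) j = b i (Suc j)" "cnt M i (Suc j) \<le> cnt M (g i) (Suc j)"
    if i: "i \<in> cyclists n M (Suc j)" for i
  proof -
    show "g i \<in> cyclists n M j" "b (g i) j = b i (Suc j)"
      using g(1)[OF i] by (auto simp: rides_def cyclists_def)
    then show "cnt M i (Suc j) \<le> cnt M (g i) (Suc j)"
      using g(2)[OF i] i j by (subst (asm) arrival_le_iff) (auto simp: cyclists_def)
  qed
  have "inj_on g (cyclists n M (Suc j))"
  proof (rule inj_onI)
    fix i i'
    assume i: "i \<in> cyclists n M (Suc j)" "i' \<in> cyclists n M (Suc j)" and "g i = g i'"
    then have "b i (Suc j) = b i' (Suc j)" using g_in(2)[OF i(1)] g_in(2)[OF i(2)] by simp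
    then show "i = i'" using rider_unique ride[OF i(1) j] ride[OF i(2) j] by metis
  qed
  then have "card (g ` cyclists n M (Suc j)) = card (cyclists n M j)"
    using card by (simp add: card_image)
  then have surj: "g ` cyclists n M (Suc j) = cyclists n M j"
    using g_in(1) by (intro card_subset_eq) auto
  show ?thesis
    unfolding handover_def
  proof
    fix x
    have "{i \<in> cyclists n M j. cnt M i (Suc j) \<le> x}
        \<subseteq> g ` {i \<in> cyclists n M (Suc j). cnt M i (Suc j) \<le> x}"
    proof clarify
      fix p
      assume p: "p \<in> cyclists n M j" "cnt M p (Suc j) \<le> x"
      then obtain i where "i \<in> cyclists n M (Suc j)" "p = g i" using surj by blast
      then show "p \<in> g ` {i \<in> cyclists n M (Suc j). cnt M i (Suc j) \<le> x}"
        using g_in(3) p(2) le_trans by blast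
    qed
    then show "card {i \<in> cyclists n M j. cnt M i (Suc j) \<le> x}
        \<le> card {i \<in> cyclists n M (Suc j). cnt M i (Suc j) \<le> x}"
      by (intro surj_card_le) auto
  qed
qed

end

subsection \<open>Sufficiency\<close>

text \<open>Iterated greedy matchings follow each bicycle from rider to rider; equal column sums
  make the injections bijective.\<close>

lemma rider_sequence:
  assumes card: "\<And>j. j < n \<Longrightarrow> card (cyclists n M j) = k"
    and hand: "\<And>j. Suc j < n \<Longrightarrow> handover n M j"
  obtains rider where
    "\<And>j. j < n \<Longrightarrow> bij_betw (\<lambda>c. rider c j) {..<k} (cyclists n M j)"
    "\<And>c j. c < k \<Longrightarrow> Suc j < n \<Longrightarrow>
       arrival v w M (rider c j) (Suc j) \<le> arrival v w M (rider c (Suc j)) (Suc j)"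
proof -
  have "\<exists>\<psi>. inj_on \<psi> (cyclists n M j) \<and> (\<forall>i\<in>cyclists n M j. \<psi> i \<in> cyclists n M (Suc j) \<and>
      cnt M (\<psi> i) (Suc j) \<le> cnt M i (Suc j))" if "Suc j < n" for j
    using hand[OF that] unfolding handover_def by (intro injection_of_counts) auto
  then obtain \<psi> where "\<forall>j. Suc j < n \<longrightarrow> inj_on (\<psi> j) (cyclists n M j) \<and>
      (\<forall>i\<in>cyclists n M j. \<psi> j i \<in> cyclists n M (Suc j) \<and> cnt M (\<psi> j i) (Suc j) \<le> cnt M i (Suc j))"
    by metis
  then have \<psi>: "inj_on (\<psi> j) (cyclists n M j)"
      "\<And>i. i \<in> cyclists n M j \<Longrightarrow> \<psi> j i \<in> cyclists n M (Suc j)"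
      "\<And>i. i \<in> cyclists n M j \<Longrightarrow> cnt M (\<psi> j i) (Suc j) \<le> cnt M i (Suc j)"
    if "Suc j < n" for j using that by blast+
  obtain h where h: "0 < n \<Longrightarrow> bij_betw h {..<k} (cyclists n M 0)"
    using card[of 0] finite_same_card_bij[of "{..<k}" "cyclists n M 0"] by auto
  define rider where "rider c = rec_nat (h c) (\<lambda>j i. \<psi> j i)" for c
  have bij: "bij_betw (\<lambda>c. rider c j) {..<k} (cyclists n M j)" if "j < n" for j
    using that
  proof (induction j)
    case 0
    then show ?case using h by (simp add: rider_def)
  next
    case (Suc j)
    then have IH: "bij_betw (\<lambda>c. rider c j) {..<k} (cyclists n M j)" by simp
    have "card (\<psi> j ` cyclists n M j) = card (cyclists n M (Suc j))"
      using card[of j] card[of "Suc j"] Suc.prems \<psi>(1)[of j] by (simp add: card_image)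
    then have "\<psi> j ` cyclists n M j = cyclists n M (Suc j)"
      using \<psi>(2)[OF Suc.prems] by (intro card_subset_eq) auto
    then have "bij_betw (\<psi> j) (cyclists n M j) (cyclists n M (Suc j))"
      using \<psi>(1)[OF Suc.prems] by (simp add: bij_betw_def)
    from bij_betw_trans[OF IH this] show ?case by (simp add: rider_def comp_def)
  qed
  have "arrival v w M (rider c j) (Suc j) \<le> arrival v w M (rider c (Suc j)) (Suc j)"
    if "c < k" "Suc j < n" for c j
  proof -
    have r: "rider c j \<in> cyclists n M j" "rider c (Suc j) \<in> cyclists n M (Suc j)"
      using bij[of j] bij[of "Suc j"] that by (auto dest: bij_betwE)
    have "cnt M (rider c (Suc j)) (Suc j) \<le> cnt M (rider c j) (Suc j)"
      using \<psi>(3)[OF that(2) r(1)] by (simp add: rider_def)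
    then show ?thesis using r that by (subst arrival_le_iff) (auto simp: cyclists_def)
  qed
  with bij show thesis using that by blast
qed

lemma execution_exists:
  assumes card: "\<And>j. j < n \<Longrightarrow> card (cyclists n M j) = k"
    and hand: "\<And>j. Suc j < n \<Longrightarrow> handover n M j"
  shows "\<exists>b pos. no_wait_execution v w n M k b pos"
proof -
  obtain rider where bij: "\<And>j. j < n \<Longrightarrow> bij_betw (\<lambda>c. rider c j) {..<k} (cyclists n M j)"
    and next_rider: "\<And>c j. c < k \<Longrightarrow> Suc j < n \<Longrightarrow>
       arrival v w M (rider c j) (Suc j) \<le> arrival v w M (rider c (Suc j)) (Suc j)"
    using rider_sequence[OF card hand] by blast
  define b where "b i j = inv_into {..<k} (\<lambda>c. rider c j) i" for i j
  define S where "S c j = arrival v w M (rider c j) j" for c j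
  \<comment> \<open>Each stage contributes its progress clamped to \<open>[0, 1]\<close>:
    \<open>0\<close> until its ride begins, \<open>1\<close> once it is over.\<close>
  define pos where "pos c t = (\<Sum>j<n. max 0 (min 1 (v * (t - S c j))))" for c t
  have rides: "rides n M b c = (\<lambda>j. (rider c j, j)) ` {..<n}" if "c < k" for c
  proof -
    have "i \<in> cyclists n M j \<and> b i j = c \<longleftrightarrow> i = rider c j" if "j < n" for i j
      using bij[OF that] \<open>c < k\<close> unfolding b_def
      by (metis bij_betwE bij_betw_inv_into_left bij_betw_inv_into_right lessThan_iff)
    then show ?thesis by (auto simp: rides_def cyclists_def)
  qed
  have finish: "arrival v w M (rider c j) (Suc j) = S c j + 1 / v" if "c < k" "j < n" for c j
    using bij[OF that(2)] that by (auto simp: S_def cyclists_def dest!: bij_betwE intro!: arrival_Suc)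
  have S_Suc: "S c j + 1 / v \<le> S c (Suc j)" if "c < k" "Suc j < n" for c j
    using next_rider[OF that] finish[of c j] that by (simp add: S_def)
  have S_less: "S c l + 1 / v \<le> S c j" if "c < k" "l < j" "j < n" for c l j
    using that(2,3)
  proof (induction j)
    case (Suc j)
    have "S c j \<le> S c (Suc j)"
      using S_Suc[OF that(1) Suc.prems(2)] speeds by (smt (verit) divide_pos_pos)
    then show ?case using Suc S_Suc[OF that(1) Suc.prems(2)] by (cases "l = j") auto
  qed simp
  have period: "ride_period v w M (rider c j, j) = {S c j ..< S c j + 1 / v}" if "c < k" "j < n" for c j
    using finish[OF that] by (simp add: ride_period_def S_def)
  have clamp0: "max 0 (min 1 (v * (t - x))) = 0" if "t \<le> x" for t x :: real
  proof -
    have "v * (t - x) \<le> 0" using that speeds by (simp add: mult_nonneg_nonpos)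
    then show ?thesis by simp
  qed
  have clamp1: "max 0 (min 1 (v * (t - x))) = 1" if "x + 1 / v \<le> t" for t x :: real
  proof -
    have "v * (1 / v) \<le> v * (t - x)" using that speeds by (intro mult_left_mono) auto
    then show ?thesis using speeds by simp
  qed
  have "no_wait_execution v w n M k b pos"
    unfolding no_wait_execution_def
  proof (intro conjI allI impI ballI; (elim conjE)?)
    fix i j
    assume "i < n" "j < n" "M $$ (i, j) = 1"
    then have "i \<in> (\<lambda>c. rider c j) ` {..<k}"
      using bij[of j] by (simp add: bij_betw_def cyclists_def)
    then show "b i j < k" unfolding b_def by (metis inv_into_into lessThan_iff)
  next
    fix c
    show "pos c 0 = 0"
      unfolding pos_def S_def by (intro sum.neutral ballI clamp0 arrival_nonneg)
  next
    fix c r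
    assume c: "c < k" and "r \<in> rides n M b c"
    then obtain j where j: "j < n" "r = (rider c j, j)" using rides by auto
    have "pos c t = real j + v * (t - S c j)" if t: "S c j \<le> t" "t \<le> S c j + 1 / v" for t
    proof -
      have D: "0 \<le> v * (t - S c j)" "v * (t - S c j) \<le> v * (1 / v)"
        using t speeds mult_left_mono[of "t - S c j" "1 / v" v] by simp_all
      have clamp: "max 0 (min 1 (v * (t - S c l))) =
          (if l \<in> {..<j} then 1 else 0) + (if l = j then v * (t - S c j) else 0)" if "l < n" for l
      proof (cases l j rule: linorder_cases)
        case less
        then show ?thesis using S_less[OF c less j(1)] t(1) by (subst clamp1) auto
      next
        case equal
        then show ?thesis using D speeds by simp
      next
        case greater
        then show ?thesis using S_less[OF c greater that] t(2) by (subst clamp0) auto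
      qed
      have "pos c t = (\<Sum>l<n. (if l \<in> {..<j} then 1 else 0) + (if l = j then v * (t - S c j) else 0))"
        unfolding pos_def by (rule sum.cong[OF refl], rule clamp) simp
      also have "\<dots> = (\<Sum>l<n. if l \<in> {..<j} then 1 else 0) +
          (\<Sum>l<n. if l = j then v * (t - S c j) else 0)"
        by (rule sum.distrib)
      also have "(\<Sum>l<n. if l \<in> {..<j} then 1 else 0) = real (card ({..<n} \<inter> {..<j}))"
        by (subst sum.inter_restrict[symmetric]) simp_all
      also have "{..<n} \<inter> {..<j} = {..<j}" using j(1) by auto
      finally show ?thesis using j(1) by simp
    qed
    then show "case r of (i, j) \<Rightarrow> \<forall>t\<in>{arrival v w M i j..arrival v w M i (Suc j)}.
        pos c t = real j + v * (t - arrival v w M i j)"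
      using finish[OF c j(1)] j by (simp add: S_def)
  next
    fix c
    assume c: "c < k"
    have disj: "ride_period v w M (rider c l, l) \<inter> ride_period v w M (rider c j, j) = {}"
      if "l < j" "j < n" for l j
      using S_less[OF c that] that c by (auto simp: period)
    show "disjoint_family_on (ride_period v w M) (rides n M b c)"
      unfolding disjoint_family_on_def rides[OF c]
    proof (intro ballI impI)
      fix r r'
      assume "r \<in> (\<lambda>j. (rider c j, j)) ` {..<n}" "r' \<in> (\<lambda>j. (rider c j, j)) ` {..<n}" "r \<noteq> r'"
      then obtain l j where lj: "r = (rider c l, l)" "r' = (rider c j, j)" "l < n" "j < n" "l \<noteq> j"
        by blast
      then consider "l < j" | "j < l" by linarith
      then show "ride_period v w M r \<inter> ride_period v w M r' = {}"
        using disj[of l j] disj[of j l] lj by cases (simp_all add: Int_commute)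
    qed
  next
    fix c s t
    assume c: "c < k" and st: "0 \<le> s" "s \<le> t"
      and rest: "\<forall>r\<in>rides n M b c. ride_period v w M r \<inter> {s..<t} = {}"
    have "max 0 (min 1 (v * (s - S c j))) = max 0 (min 1 (v * (t - S c j)))" if j: "j < n" for j
    proof -
      have disj: "{S c j ..< S c j + 1 / v} \<inter> {s..<t} = {}"
        unfolding period[OF c j, symmetric] using rest rides[OF c] j by simp
      have v: "0 < 1 / v" using speeds by simp
      \<comment> \<open>A stretch missing the ride is empty or lies wholly before or after it, where
        the clamped term is constant; in the fourth case \<open>max s (S c j)\<close> would be a
        common point.\<close>
      consider "s = t" | "t \<le> S c j" | "S c j + 1 / v \<le> s" | "s < t" "S c j < t" "s < S c j + 1 / v"
        using st by linarith
      then show ?thesis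
      proof cases
        case 4
        then have "max s (S c j) \<in> {S c j ..< S c j + 1 / v} \<inter> {s..<t}" using v by auto
        with disj show ?thesis by blast
      qed (use st clamp0 clamp1 in auto)
    qed
    then show "pos c s = pos c t" unfolding pos_def by (intro sum.cong) auto
  qed
  then show ?thesis by blast
qed

text \<open>The right-hand side is free of \<open>v\<close> and \<open>w\<close>, so one run of the
  program answers for all speeds at once.\<close>

lemma optimal_iff:
  "optimal v w n M \<longleftrightarrow> (\<exists>k. k_uniform n k M) \<and> (\<forall>j. Suc j < n \<longrightarrow> handover n M j)"
proof -
  have card: "card (cyclists n M j) = k" if "k_uniform n k M" "j < n" for k j
    using that by (simp add: k_uniform_def cyclists_def)
  show ?thesis
    unfolding optimal_def
  proof (intro iffI)
    assume "\<exists>k. k_uniform n k M \<and> (\<exists>b pos. no_wait_execution v w n M k b pos)"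
    then obtain k b pos where k: "k_uniform n k M" and e: "no_wait_execution v w n M k b pos"
      by blast
    have "handover n M j" if "Suc j < n" for j
      by (rule handover_necessary[OF e that]) (use card[OF k] that in simp)
    then show "(\<exists>k. k_uniform n k M) \<and> (\<forall>j. Suc j < n \<longrightarrow> handover n M j)" using k by blast
  next
    assume "(\<exists>k. k_uniform n k M) \<and> (\<forall>j. Suc j < n \<longrightarrow> handover n M j)"
    then obtain k where k: "k_uniform n k M" and "\<And>j. Suc j < n \<Longrightarrow> handover n M j" by blast
    then have "\<exists>b pos. no_wait_execution v w n M k b pos"
      using execution_exists[OF card[OF k]] by blast
    with k show "\<exists>k. k_uniform n k M \<and> (\<exists>b pos. no_wait_execution v w n M k b pos)" by blast
  qed
qed

end

section \<open>The decision procedure within the time bound\<close>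

theorem theorem3p12:
  shows "\<exists>(p :: prog) (T :: nat \<Rightarrow> nat).
    (\<lambda>n. real (T n)) \<in> O(\<lambda>n. real n ^ 2 * ln (real n)) \<and>
    (\<forall>(n :: nat) (M :: nat mat). n \<ge> 1 \<and> binary_mat n M \<longrightarrow>
       (\<exists>t s. exec p (input_state n M) t s \<and> t \<le> T n \<and>
          (\<forall>(v :: real) (w :: real). 0 < w \<and> w < v \<longrightarrow>
             answer s = (if optimal v w n M then 1 else 0))))"
proof (intro exI[of _ decide_prog] exI[of _ "\<lambda>n. 60 * n\<^sup>2"] conjI allI impI)
  show "(\<lambda>n. real (60 * n\<^sup>2)) \<in> O(\<lambda>n. real n ^ 2 * ln (real n))"
  proof (rule bigoI[where c = 60], rule eventually_sequentiallyI)
    \<comment> \<open>From \<open>3\<close>, which exceeds \<open>exp 1\<close>, on, the logarithm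
      is at least \<open>1\<close>; at \<open>n = 1\<close> it vanishes, so the comparison holds
      only eventually.\<close>
    fix n :: nat
    assume "n \<ge> 3"
    then have "exp 1 \<le> real n" using exp_le by linarith
    then have "1 \<le> ln (real n)" using \<open>n \<ge> 3\<close> by (simp add: ln_ge_iff)
    then have "real n ^ 2 * 1 \<le> real n ^ 2 * ln (real n)" by (intro mult_left_mono) auto
    then show "norm (real (60 * n\<^sup>2)) \<le> 60 * norm (real n ^ 2 * ln (real n))" by simp
  qed
next
  fix n :: nat and M :: "nat mat"
  assume nM: "1 \<le> n \<and> binary_mat n M"
  then obtain t s where ts: "exec decide_prog (input_state n M) t s" "t \<le> 60 * n\<^sup>2"
      "answer s = of_bool (criterion n M)"
    using decide_prog_correct unfolding wp_def by blast
  have "answer s = (if optimal v w n M then 1 else 0)" if "0 < w \<and> w < v" for v w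
    using ts(3) optimal_iff[of w v n M] criterion_iff[of n M] nM that by simp
  with ts show "\<exists>t s. exec decide_prog (input_state n M) t s \<and> t \<le> 60 * n\<^sup>2 \<and>
      (\<forall>v w. 0 < w \<and> w < v \<longrightarrow> answer s = (if optimal v w n M then 1 else 0))" by blast
qed

end
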